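(* Let $C$ be a commutative $\mathbb{Q}$-algebra and let $\lambda\in C$. The pairings $\langle\ \mid\ \rangle_0$ and $\langle\ \mid\ \rangle_\lambda$ are compatible; that is, their extensions $[\ \mid\ ]_0$ and $[\ \mid\ ]_\lambda$ to pairings $C[t]\otimes C[[x]]\to C$ coincide: $$[g(t)\mid h(x)]_0=[g(t)\mid h(x)]_\lambda\quad\text{for all }g(t)\in C[t],\ h(x)\in C[[x]].$$
   Context: For $n\ge0$ let $\tau_{\lambda,n}(t)=\frac{t(t-\lambda)\cdots(t-(n-1)\lambda)}{n!}\in C[t]$ (so $\tau_{\lambda,0}=1$ and $\tau_{0,n}=t^n/n!$), and let $e_\lambda(x)=\sum_{k=1}^\infty\frac{\lambda^{k-1}x^k}{k!}\in C[[x]]$ (so $e_0(x)=x$). The $\tau_{\lambda,n}(t)$ form a basis of the $C$-module $C[t]$, and every element of $C[[x]]$ is uniquely a convergent series $\sum_kd_k\,e_\lambda(x)^k$ with $d_k\in C$. Let $\mathfrak{q}=\{e_\lambda(x)^k\}_{k\ge 0}$ and let $C\langle\mathfrak{q}\rangle$ be the $C$-submodule of $C[[x]]$ generated by $\mathfrak{q}$. The pairing $\langle\ \mid\ \rangle_\lambda:C[t]\otimes C\langle\mathfrak{q}\rangle\to C$ is the $C$-bilinear pairing with $\langle\tau_{\lambda,n}(t)\mid e_\lambda(x)^k\rangle_\lambda=\delta_{n,k}$ for all $n,k\ge 0$. Its extension $[\ \mid\ ]_\lambda:C[t]\otimes C[[x]]\to C$ is given by $[\tau_{\lambda,n}(t)\mid\sum_kd_k\,e_\lambda(x)^k]_\lambda=d_n$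 and $C$-linearity in the first variable. The case $\lambda=0$ gives $\langle\ \mid\ \rangle_0:C[t]\otimes C[x]\to C$ with $\langle t^n/n!\mid x^k\rangle_0=\delta_{n,k}$, and its extension $[\ \mid\ ]_0:C[t]\otimes C[[x]]\to C$ with $[t^n/n!\mid\sum_kd_kx^k]_0=d_n$. *)

theory Defs
  imports "HOL-Computational_Algebra.Computational_Algebra"
begin

section \<open>Commutative algebras over the rationals\<close>

class scaleQ =
  fixes scaleQ :: "rat \<Rightarrow> 'a \<Rightarrow> 'a"  (infixr \<open>*\<^sub>Q\<close> 75)

text \<open>Modelled on \<open>real_algebra_1\<close>. As for all unital rings of the library, \<open>0 \<noteq> 1\<close>.\<close>

class comm_rat_algebra_1 = scaleQ + comm_ring_1 +
  assumes scaleQ_add_right: "a *\<^sub>Q (x + y) = a *\<^sub>Q x + a *\<^sub>Q y"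
    and scaleQ_add_left: "(a + b) *\<^sub>Q x = a *\<^sub>Q x + b *\<^sub>Q x"
    and scaleQ_scaleQ: "a *\<^sub>Q b *\<^sub>Q x = (a * b) *\<^sub>Q x"
    and scaleQ_one: "1 *\<^sub>Q x = x"
    and mult_scaleQ_left: "a *\<^sub>Q x * y = a *\<^sub>Q (x * y)"

instantiation rat :: comm_rat_algebra_1
begin

definition scaleQ_rat :: "rat \<Rightarrow> rat \<Rightarrow> rat" where
  "scaleQ_rat a x = a * x"

instance
  by standard (simp_all add: scaleQ_rat_def algebra_simps)

end


section \<open>The basis of \<open>C[t]\<close> and the topological basis of \<open>C[[x]]\<close>\<close>

definition tau :: "'a::comm_rat_algebra_1 \<Rightarrow> nat \<Rightarrow> 'a poly" where
  "tau lam n = smult ((1 / fact n) *\<^sub>Q 1) (\<Prod>i<n. [:- (of_nat i * lam), 1:])"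

definition e_fps :: "'a::comm_rat_algebra_1 \<Rightarrow> 'a fps" where
  "e_fps lam = Abs_fps (\<lambda>k. if k = 0 then 0 else (1 / fact k) *\<^sub>Q lam ^ (k - 1))"

definition tau_expansion :: "'a::comm_rat_algebra_1 \<Rightarrow> 'a poly \<Rightarrow> (nat \<Rightarrow> 'a) \<Rightarrow> bool" where
  "tau_expansion lam g c \<longleftrightarrow>
     finite {n. c n \<noteq> 0} \<and> g = (\<Sum>n | c n \<noteq> 0. smult (c n) (tau lam n))"

text \<open>Convergence is with respect to the metric of the library on formal power series, that is,
  in the \<open>x\<close>-adic topology.\<close>

definition e_expansion :: "'a::comm_rat_algebra_1 \<Rightarrow> 'a fps \<Rightarrow> (nat \<Rightarrow> 'a) \<Rightarrow> bool" where
  "e_expansion lam h d \<longleftrightarrow> (\<lambda>k. fps_const (d k) * e_fps lam ^ k) sums h"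

text \<open>Both definite descriptions are well defined, see \<open>tau_expansion_ex1\<close> and
  \<open>e_expansion_ex1\<close> below.\<close>

definition tau_coeffs :: "'a::comm_rat_algebra_1 \<Rightarrow> 'a poly \<Rightarrow> nat \<Rightarrow> 'a" where
  "tau_coeffs lam g = (THE c. tau_expansion lam g c)"

definition e_coeffs :: "'a::comm_rat_algebra_1 \<Rightarrow> 'a fps \<Rightarrow> nat \<Rightarrow> 'a" where
  "e_coeffs lam h = (THE d. e_expansion lam h d)"


section \<open>The pairings\<close>

text \<open>The predicate characterizes \<open>\<langle> | \<rangle>\<^sub>\<lambda>\<close> on \<open>C[t] \<times> C\<langle>q\<rangle>\<close>, where \<open>C\<langle>q\<rangle>\<close> is \<open>q_span\<close>; the
  values of \<open>P\<close> elsewhere are irrelevant. By \<open>is_pairing_ext_pairing\<close> and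
  \<open>is_pairing_imp_eq_ext_pairing\<close> below, this pairing exists, is unique, and is the restriction
  of \<open>ext_pairing\<close>.\<close>

definition q_span :: "'a::comm_rat_algebra_1 \<Rightarrow> 'a fps set" where
  "q_span lam = module.span (\<lambda>c f. fps_const c * f) (range (\<lambda>k. e_fps lam ^ k))"

definition is_pairing ::
    "'a::comm_rat_algebra_1 \<Rightarrow> ('a poly \<Rightarrow> 'a fps \<Rightarrow> 'a) \<Rightarrow> bool" where
  "is_pairing lam P \<longleftrightarrow>
     (\<forall>g g'. \<forall>f\<in>q_span lam. P (g + g') f = P g f + P g' f) \<and>
     (\<forall>c g. \<forall>f\<in>q_span lam. P (smult c g) f = c * P g f) \<and>
     (\<forall>g. \<forall>f\<in>q_span lam. \<forall>f'\<in>q_span lam. P g (f + f') = P g f + P g f') \<and>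
     (\<forall>c g. \<forall>f\<in>q_span lam. P g (fps_const c * f) = c * P g f) \<and>
     (\<forall>n k. P (tau lam n) (e_fps lam ^ k) = (if n = k then 1 else 0))"

text \<open>The extended pairing \<open>[g | h]\<^sub>\<lambda>\<close>: the value \<open>[\<tau>\<^sub>n | \<Sum>\<^sub>k d\<^sub>k e\<^sup>k] = d\<^sub>n\<close>,
  extended linearly in \<open>g\<close>.\<close>

definition ext_pairing :: "'a::comm_rat_algebra_1 \<Rightarrow> 'a poly \<Rightarrow> 'a fps \<Rightarrow> 'a" where
  "ext_pairing lam g h =
     (\<Sum>n | tau_coeffs lam g n \<noteq> 0. tau_coeffs lam g n * e_coeffs lam h n)"


section \<open>The defining properties hold\<close>

subsection \<open>Expansions of polynomials\<close>

lemma module_scaleQ_zero: "a *\<^sub>Q (0::'a::comm_rat_algebra_1) = 0"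
  using scaleQ_add_right[of a "0::'a" 0] by simp

lemma scaleQ_one_mult: "(a *\<^sub>Q 1) * (x::'a::comm_rat_algebra_1) = a *\<^sub>Q x"
  by (simp add: mult_scaleQ_left)

lemma of_nat_scaleQ: "of_nat n *\<^sub>Q (x::'a::comm_rat_algebra_1) = of_nat n * x"
proof (induction n)
  case 0
  have "0 *\<^sub>Q x = 0"
    using scaleQ_add_left[of 0 0 x] by simp
  then show ?case by simp
next
  case (Suc n)
  then show ?case
    by (simp add: scaleQ_add_left scaleQ_one algebra_simps)
qed

lemma fact_scaleQ: "of_nat (fact n) * ((1 / fact n) *\<^sub>Q (1::'a::comm_rat_algebra_1)) = 1"
proof -
  have "of_nat (fact n) * ((1 / fact n) *\<^sub>Q (1::'a)) = of_nat (fact n) *\<^sub>Q (1 / fact n) *\<^sub>Q 1"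
    by (rule of_nat_scaleQ[symmetric])
  also have "\<dots> = 1"
    by (simp add: scaleQ_scaleQ scaleQ_one)
  finally show ?thesis .
qed

lemma falling_poly:
  fixes lam :: "'a::comm_ring_1"
  defines "p \<equiv> \<lambda>n. \<Prod>i<n. [:- (of_nat i * lam), 1:]"
  shows "coeff (p n) n = 1" and "m > n \<Longrightarrow> coeff (p n) m = 0"
proof -
  have "coeff (p n) n = 1 \<and> (\<forall>m>n. coeff (p n) m = 0)"
  proof (induction n)
    case 0
    show ?case by (simp add: p_def)
  next
    case (Suc n)
    have eq: "p (Suc n) = smult (- (of_nat n * lam)) (p n) + pCons 0 (p n)"
      by (simp add: p_def mult.commute)
    show ?case
      unfolding eq using Suc by (auto simp: coeff_pCons split: nat.split)
  qed
  then show "coeff (p n) n = 1" and "m > n \<Longrightarrow> coeff (p n) m = 0"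
    by auto
qed

lemma coeff_tau_self: "coeff (tau lam n) n = (1 / fact n) *\<^sub>Q 1"
  by (simp add: tau_def falling_poly)

lemma coeff_tau_eq_0: "m > n \<Longrightarrow> coeff (tau lam n) m = 0"
  by (simp add: tau_def falling_poly)

lemma tau_spans:
  fixes g :: "'a::comm_rat_algebra_1 poly"
  assumes "\<forall>m\<ge>N. coeff g m = 0"
  shows "\<exists>c. (\<forall>n\<ge>N. c n = 0) \<and> g = (\<Sum>n<N. smult (c n) (tau lam n))"
  using assms
proof (induction N arbitrary: g)
  case 0
  then have "g = 0" by (auto simp: poly_eq_iff)
  then show ?case by (intro exI[of _ "\<lambda>_. 0"]) simp
next
  case (Suc N)
  define a where "a = of_nat (fact N) * coeff g N"
  define g' where "g' = g - smult a (tau lam N)"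
  have "a * ((1 / fact N) *\<^sub>Q 1) = coeff g N * (of_nat (fact N) * ((1 / fact N) *\<^sub>Q 1))"
    by (simp add: a_def mult_ac)
  then have "coeff g' N = 0"
    by (simp add: g'_def coeff_tau_self fact_scaleQ)
  moreover have "coeff g' m = 0" if "m > N" for m
    using that Suc.prems by (simp add: g'_def coeff_tau_eq_0)
  ultimately have "\<forall>m\<ge>N. coeff g' m = 0"
    by (metis le_neq_implies_less)
  then obtain c where c: "\<forall>n\<ge>N. c n = 0" "g' = (\<Sum>n<N. smult (c n) (tau lam n))"
    using Suc.IH by blast
  have "g = g' + smult a (tau lam N)" by (simp add: g'_def)
  also have "\<dots> = (\<Sum>n<Suc N. smult ((c(N := a)) n) (tau lam n))"
    by (simp add: c(2))
  finally show ?case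
    using c(1) by (intro exI[of _ "c(N := a)"]) auto
qed

lemma tau_independent:
  fixes lam :: "'a::comm_rat_algebra_1"
  assumes "(\<Sum>n<N. smult (c n) (tau lam n)) = 0" and "n < N"
  shows "c n = 0"
  using assms
proof (induction N arbitrary: n)
  case 0
  then show ?case by simp
next
  case (Suc N)
  have "coeff (\<Sum>n<N. smult (c n) (tau lam n)) N = 0"
    by (simp add: coeff_sum coeff_tau_eq_0)
  then have "c N * ((1 / fact N) *\<^sub>Q 1) = 0"
    using Suc.prems(1) coeff_tau_self[of lam N] by (metis (no_types, lifting) add_0 coeff_0 coeff_add coeff_smult sum.lessThan_Suc)
  then have "c N * (of_nat (fact N) * ((1 / fact N) *\<^sub>Q 1)) = 0"
    by (metis mult.left_commute mult_zero_right)
  then have cN: "c N = 0" by (simp add: fact_scaleQ)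
  then have "(\<Sum>n<N. smult (c n) (tau lam n)) = 0"
    using Suc.prems(1) by simp
  then show ?case using Suc.IH Suc.prems(2) cN by (metis less_Suc_eq)
qed

lemma tau_expansion_iff:
  "tau_expansion lam g c \<longleftrightarrow>
     (\<exists>N. (\<forall>n\<ge>N. c n = 0) \<and> g = (\<Sum>n<N. smult (c n) (tau lam n)))" (is "?L \<longleftrightarrow> ?R")
proof
  assume L: ?L
  then obtain N where N: "\<forall>n\<in>{n. c n \<noteq> 0}. n < N"
    using finite_nat_set_iff_bounded by (auto simp: tau_expansion_def)
  have "(\<Sum>n | c n \<noteq> 0. smult (c n) (tau lam n)) = (\<Sum>n<N. smult (c n) (tau lam n))"
    using N by (intro sum.mono_neutral_left) auto
  with L N show ?R
    by (intro exI[of _ N]) (auto simp: tau_expansion_def not_less[symmetric])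
next
  assume ?R
  then obtain N where N: "\<forall>n\<ge>N. c n = 0" "g = (\<Sum>n<N. smult (c n) (tau lam n))" by blast
  then have sub: "{n. c n \<noteq> 0} \<subseteq> {..<N}" by (auto simp: not_le[symmetric])
  then have "(\<Sum>n | c n \<noteq> 0. smult (c n) (tau lam n)) = (\<Sum>n<N. smult (c n) (tau lam n))"
    by (intro sum.mono_neutral_left) auto
  with N sub show ?L
    by (auto simp: tau_expansion_def intro: finite_subset)
qed

lemma tau_expansion_add:
  assumes "tau_expansion lam g c" "tau_expansion lam g' c'"
  shows "tau_expansion lam (g + smult a g') (\<lambda>n. c n + a * c' n)"
proof -
  from assms obtain N N' where
    N: "\<forall>n\<ge>N. c n = 0" "g = (\<Sum>n<N. smult (c n) (tau lam n))" and
    N': "\<forall>n\<ge>N'. c' n = 0" "g' = (\<Sum>n<N'. smult (c' n) (tau lam n))"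
    unfolding tau_expansion_iff by blast
  define M where "M = max N N'"
  have "g = (\<Sum>n<M. smult (c n) (tau lam n))"
    unfolding N(2) using N(1) by (intro sum.mono_neutral_left) (auto simp: M_def)
  moreover have "g' = (\<Sum>n<M. smult (c' n) (tau lam n))"
    unfolding N'(2) using N'(1) by (intro sum.mono_neutral_left) (auto simp: M_def)
  ultimately have "g + smult a g' = (\<Sum>n<M. smult (c n + a * c' n) (tau lam n))"
    by (simp add: poly_eq_iff coeff_sum sum.distrib sum_distrib_left algebra_simps)
  then show ?thesis
    unfolding tau_expansion_iff using N(1) N'(1) by (intro exI[of _ M]) (auto simp: M_def)
qed

lemma tau_expansion_ex1: "\<exists>!c. tau_expansion lam g c"
proof (rule ex_ex1I)
  show "\<exists>c. tau_expansion lam g c"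
    unfolding tau_expansion_iff
    using tau_spans[of "Suc (degree g)" g lam] by (metis coeff_eq_0 Suc_le_lessD)
next
  fix c c' assume "tau_expansion lam g c" "tau_expansion lam g c'"
  from tau_expansion_add[OF this, of "-1"]
  obtain N where N: "\<forall>n\<ge>N. c n + - 1 * c' n = 0"
    "(\<Sum>n<N. smult (c n + - 1 * c' n) (tau lam n)) = 0"
    unfolding tau_expansion_iff by force
  have "c n + - 1 * c' n = 0" for n
    using N tau_independent[OF N(2)] by (cases "n < N") auto
  then show "c = c'" by (auto simp: fun_eq_iff)
qed

lemma tau_expansion_tau_coeffs: "tau_expansion lam g (tau_coeffs lam g)"
  unfolding tau_coeffs_def by (rule theI'[OF tau_expansion_ex1])

lemma tau_coeffs_eqI: "tau_expansion lam g c \<Longrightarrow> tau_coeffs lam g = c"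
  using tau_expansion_ex1 tau_expansion_tau_coeffs by blast

lemma tau_coeffs_tau: "tau_coeffs lam (tau lam n) = (\<lambda>m. if m = n then 1 else 0)"
proof (rule tau_coeffs_eqI)
  show "tau_expansion lam (tau lam n) (\<lambda>m. if m = n then 1 else 0)"
    unfolding tau_expansion_iff
    by (intro exI[of _ "Suc n"]) (auto simp: if_distrib[of "\<lambda>c. smult c _"] cong: if_cong)
qed


subsection \<open>Expansions of power series\<close>

lemma e_fps_power_nth:
  fixes lam :: "'a::comm_rat_algebra_1"
  shows "i < k \<Longrightarrow> fps_nth (e_fps lam ^ k) i = 0"
    and "fps_nth (e_fps lam ^ k) k = 1"
proof -
  have e0: "fps_nth (e_fps lam) 0 = 0" and e1: "fps_nth (e_fps lam) 1 = 1"
    by (simp_all add: e_fps_def scaleQ_one)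
  show "i < k \<Longrightarrow> fps_nth (e_fps lam ^ k) i = 0"
    using e0 startsby_zero_power_prefix by blast
  show "fps_nth (e_fps lam ^ k) k = 1"
    using startsby_zero_power_nth_same[OF e0, of k] e1 by simp
qed

lemma e_expansion_iff:
  "e_expansion lam h d \<longleftrightarrow>
     (\<forall>i. fps_nth h i = (\<Sum>k\<le>i. d k * fps_nth (e_fps lam ^ k) i))"
proof -
  have partial: "fps_nth (\<Sum>k<n. fps_const (d k) * e_fps lam ^ k) i =
      (\<Sum>k\<le>i. d k * fps_nth (e_fps lam ^ k) i)" if "n > i" for n i
  proof -
    have "fps_nth (\<Sum>k<n. fps_const (d k) * e_fps lam ^ k) i =
        (\<Sum>k<n. d k * fps_nth (e_fps lam ^ k) i)"
      by (simp add: fps_sum_nth)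
    also have "\<dots> = (\<Sum>k\<le>i. d k * fps_nth (e_fps lam ^ k) i)"
      using that by (intro sum.mono_neutral_right) (auto simp: e_fps_power_nth)
    finally show ?thesis .
  qed
  have ev: "(\<forall>\<^sub>F n in sequentially.
        fps_nth (\<Sum>k<n. fps_const (d k) * e_fps lam ^ k) i = fps_nth h i) \<longleftrightarrow>
      fps_nth h i = (\<Sum>k\<le>i. d k * fps_nth (e_fps lam ^ k) i)" (is "?E \<longleftrightarrow> ?R") for i
  proof
    assume ?E
    then have "\<forall>\<^sub>F n in sequentially. n > i \<and>
        fps_nth (\<Sum>k<n. fps_const (d k) * e_fps lam ^ k) i = fps_nth h i"
      using eventually_gt_at_top eventually_conj by blast
    then obtain n where "n > i"
      "fps_nth (\<Sum>k<n. fps_const (d k) * e_fps lam ^ k) i = fps_nth h i"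
      using eventually_happens by force
    then show ?R using partial by metis
  next
    assume R: ?R
    show ?E
      using eventually_gt_at_top[of i] by eventually_elim (use R partial in metis)
  qed
  show ?thesis
    unfolding e_expansion_def sums_def tendsto_fps_iff ev ..
qed

lemma e_expansion_ex1: "\<exists>!d. e_expansion lam h d"
proof (rule ex_ex1I)
  define step where "step = (\<lambda>xs. let i = length xs in
     xs @ [fps_nth h i - (\<Sum>k<i. xs ! k * fps_nth (e_fps lam ^ k) i)])"
  define L where "L = (\<lambda>n. (step ^^ n) [])"
  define d where "d = (\<lambda>n. L (Suc n) ! n)"
  have L_Suc: "L (Suc n) = step (L n)" for n by (simp add: L_def)
  have len: "length (L n) = n" for n
    by (induction n) (simp_all add: L_Suc step_def Let_def, simp add: L_def)
  have L_nth: "L n ! k = d k" if "k < n" for n k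
    using that
  proof (induction n)
    case (Suc n)
    show ?case
    proof (cases "k = n")
      case False
      then have "k < n" using Suc.prems by simp
      then show ?thesis
        using Suc.IH by (simp add: L_Suc step_def Let_def nth_append len)
    qed (simp add: d_def)
  qed simp
  have d_eq: "d i = fps_nth h i - (\<Sum>k<i. d k * fps_nth (e_fps lam ^ k) i)" for i
  proof -
    have "L (Suc i) ! i = fps_nth h i - (\<Sum>k<i. L i ! k * fps_nth (e_fps lam ^ k) i)"
      by (simp add: L_Suc step_def Let_def nth_append len)
    also have "\<dots> = fps_nth h i - (\<Sum>k<i. d k * fps_nth (e_fps lam ^ k) i)"
      by (simp add: L_nth)
    finally show ?thesis by (simp add: d_def)
  qed
  have "e_expansion lam h d"
    unfolding e_expansion_iff
  proof
    fix i
    have "(\<Sum>k\<le>i. d k * fps_nth (e_fps lam ^ k) i) =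
        (\<Sum>k<i. d k * fps_nth (e_fps lam ^ k) i) + d i"
      by (simp add: e_fps_power_nth flip: lessThan_Suc_atMost)
    then show "fps_nth h i = (\<Sum>k\<le>i. d k * fps_nth (e_fps lam ^ k) i)"
      using d_eq[of i] by simp
  qed
  then show "\<exists>d. e_expansion lam h d" by blast
next
  fix d d' assume *: "e_expansion lam h d" "e_expansion lam h d'"
  have "d i = d' i" for i
  proof (induction i rule: less_induct)
    case (less i)
    have "(\<Sum>k<i. d k * fps_nth (e_fps lam ^ k) i) + d i =
        (\<Sum>k<i. d' k * fps_nth (e_fps lam ^ k) i) + d' i"
      using *[unfolded e_expansion_iff, THEN spec, of i]
      by (simp add: e_fps_power_nth flip: lessThan_Suc_atMost)
    moreover have "(\<Sum>k<i. d k * fps_nth (e_fps lam ^ k) i) =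
        (\<Sum>k<i. d' k * fps_nth (e_fps lam ^ k) i)"
      using less by simp
    ultimately show ?case by simp
  qed
  then show "d = d'" ..
qed

lemma e_expansion_e_coeffs: "e_expansion lam h (e_coeffs lam h)"
  unfolding e_coeffs_def by (rule theI'[OF e_expansion_ex1])

lemma e_coeffs_eqI: "e_expansion lam h d \<Longrightarrow> e_coeffs lam h = d"
  using e_expansion_ex1 e_expansion_e_coeffs by blast

lemma e_coeffs_add: "e_coeffs lam (h + h') n = e_coeffs lam h n + e_coeffs lam h' n"
proof -
  have "e_expansion lam (h + h') (\<lambda>n. e_coeffs lam h n + e_coeffs lam h' n)"
    using e_expansion_e_coeffs[of lam h] e_expansion_e_coeffs[of lam h']
    by (simp add: e_expansion_iff sum.distrib algebra_simps)
  from e_coeffs_eqI[OF this] show ?thesis by simp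
qed

lemma e_coeffs_const_mult: "e_coeffs lam (fps_const c * h) n = c * e_coeffs lam h n"
proof -
  have "e_expansion lam (fps_const c * h) (\<lambda>n. c * e_coeffs lam h n)"
    using e_expansion_e_coeffs[of lam h]
    by (simp add: e_expansion_iff sum_distrib_left mult.assoc)
  from e_coeffs_eqI[OF this] show ?thesis by simp
qed

lemma e_coeffs_power: "e_coeffs lam (e_fps lam ^ k) = (\<lambda>n. if n = k then 1 else 0)"
proof (rule e_coeffs_eqI)
  show "e_expansion lam (e_fps lam ^ k) (\<lambda>n. if n = k then 1 else 0)"
    by (auto simp: e_expansion_iff e_fps_power_nth if_distrib[of "\<lambda>c. c * _"] cong: if_cong)
qed


subsection \<open>Properties of the pairings\<close>

lemma ext_pairing_eq_sum:
  assumes "\<forall>n\<ge>N. tau_coeffs lam g n = 0"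
  shows "ext_pairing lam g h = (\<Sum>n<N. tau_coeffs lam g n * e_coeffs lam h n)"
  unfolding ext_pairing_def using assms
  by (intro sum.mono_neutral_left) (auto simp: not_le[symmetric])

lemma tau_coeffs_bounded: "\<exists>N. \<forall>n\<ge>N. tau_coeffs lam g n = 0"
  using tau_expansion_tau_coeffs[of lam g] unfolding tau_expansion_iff by blast

lemma ext_pairing_lincomb_left:
  "ext_pairing lam (g + smult a g') h = ext_pairing lam g h + a * ext_pairing lam g' h"
proof -
  have c: "tau_coeffs lam (g + smult a g') = (\<lambda>n. tau_coeffs lam g n + a * tau_coeffs lam g' n)"
    by (intro tau_coeffs_eqI tau_expansion_add tau_expansion_tau_coeffs)
  obtain N N' where N: "\<forall>n\<ge>N. tau_coeffs lam g n = 0" "\<forall>n\<ge>N'. tau_coeffs lam g' n = 0"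
    using tau_coeffs_bounded by metis
  define M where "M = max N N'"
  have "\<forall>n\<ge>M. tau_coeffs lam g n = 0" "\<forall>n\<ge>M. tau_coeffs lam g' n = 0"
    "\<forall>n\<ge>M. tau_coeffs lam (g + smult a g') n = 0"
    using N by (auto simp: M_def c)
  from this[THEN ext_pairing_eq_sum] show ?thesis
    by (simp add: c sum.distrib sum_distrib_left algebra_simps)
qed

lemma ext_pairing_add_left: "ext_pairing lam (g + g') h = ext_pairing lam g h + ext_pairing lam g' h"
  using ext_pairing_lincomb_left[of lam g 1 g' h] by simp

lemma ext_pairing_zero_left: "ext_pairing lam 0 h = 0"
  using ext_pairing_add_left[of lam 0 0 h] by simp

lemma ext_pairing_smult_left: "ext_pairing lam (smult c g) h = c * ext_pairing lam g h"
  using ext_pairing_lincomb_left[of lam 0 c g h] by (simp add: ext_pairing_zero_left)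

lemma ext_pairing_tau:
  assumes "(\<lambda>k. fps_const (d k) * e_fps lam ^ k) sums h"
  shows "ext_pairing lam (tau lam n) h = d n"
proof -
  have "e_coeffs lam h = d"
    using assms by (intro e_coeffs_eqI) (simp add: e_expansion_def)
  then show ?thesis by (simp add: ext_pairing_def tau_coeffs_tau)
qed

lemma tau_0: "tau lam 0 = 1"
  by (simp add: tau_def scaleQ_one)

lemma tau_zero: "tau 0 n = monom ((1 / fact n) *\<^sub>Q 1) n"
  by (simp add: tau_def monom_altdef)

lemma e_fps_zero: "e_fps (0::'a::comm_rat_algebra_1) = fps_X"
  by (rule fps_ext) (auto simp: e_fps_def fps_X_def scaleQ_one module_scaleQ_zero power_0_left)

lemma module_fps: "module (\<lambda>c (f :: 'a::comm_rat_algebra_1 fps). fps_const c * f)"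
  by standard (simp_all add: algebra_simps flip: fps_const_add fps_const_mult)

lemma is_pairing_ext_pairing: "is_pairing lam (ext_pairing lam)"
  unfolding is_pairing_def
proof (intro conjI allI ballI)
  fix g f f' c n k
  show "ext_pairing lam g (f + f') = ext_pairing lam g f + ext_pairing lam g f'"
    by (simp add: ext_pairing_def e_coeffs_add sum.distrib distrib_left)
  show "ext_pairing lam g (fps_const c * f) = c * ext_pairing lam g f"
    by (simp add: ext_pairing_def e_coeffs_const_mult sum_distrib_left mult.left_commute)
  show "ext_pairing lam (tau lam n) (e_fps lam ^ k) = (if n = k then 1 else 0)"
    by (simp add: ext_pairing_def tau_coeffs_tau e_coeffs_power)
qed (simp_all add: ext_pairing_add_left ext_pairing_smult_left)

lemma is_pairing_imp_eq_ext_pairing: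
  fixes lam :: "'a::comm_rat_algebra_1"
  assumes P: "is_pairing lam P" and f: "f \<in> q_span lam"
  shows "P g f = ext_pairing lam g f"
proof -
  interpret M: module "\<lambda>c (f :: 'a fps). fps_const c * f" by (rule module_fps)
  have span: "q_span lam = M.span (range (\<lambda>k. e_fps lam ^ k))" by (simp add: q_span_def)
  have add_left: "P (g + g') f = P g f + P g' f" for g g'
    using P f by (simp add: is_pairing_def)
  have smult_left: "P (smult c g) f = c * P g f" for c g
    using P f by (simp add: is_pairing_def)
  have "f \<in> q_span lam \<and> P (tau lam n) f = ext_pairing lam (tau lam n) f" for n
    using f[unfolded span]
  proof (induction f rule: M.span_induct_alt)
    case base
    have zero: "0 \<in> q_span lam" unfolding span by (rule M.span_zero)
    have "P' (tau lam n) 0 = 0" if P': "is_pairing lam P'" for P'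
    proof -
      have "P' (tau lam n) (fps_const 0 * 0) = 0 * P' (tau lam n) 0"
        using P' zero unfolding is_pairing_def by blast
      then show ?thesis by simp
    qed
    from this[OF P] this[OF is_pairing_ext_pairing] zero show ?case by simp
  next
    case (step c x y)
    have x: "x \<in> q_span lam" unfolding span using step(1) by (rule M.span_base)
    have y: "y \<in> q_span lam" using step by blast
    obtain k where k: "x = e_fps lam ^ k" using step(1) by blast
    have cx: "fps_const c * x \<in> q_span lam"
      using x unfolding span by (rule M.span_scale)
    have lin: "P' (tau lam n) (fps_const c * x + y) =
        c * (if n = k then 1 else 0) + P' (tau lam n) y" if P': "is_pairing lam P'" for P'
    proof -
      have "P' (tau lam n) (fps_const c * x + y) = P' (tau lam n) (fps_const c * x) + P' (tau lam n) y"
        using P' cx y unfolding is_pairing_def by blast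
      also have "P' (tau lam n) (fps_const c * x) = c * P' (tau lam n) x"
        using P' x unfolding is_pairing_def by blast
      also have "P' (tau lam n) x = (if n = k then 1 else 0)"
        using P' unfolding k is_pairing_def by blast
      finally show ?thesis .
    qed
    have "fps_const c * x + y \<in> q_span lam"
      using cx y unfolding span by (rule M.span_add)
    with step lin[OF P] lin[OF is_pairing_ext_pairing] show ?case by simp
  qed
  then have tau: "P (tau lam n) f = ext_pairing lam (tau lam n) f" for n by blast
  have sum: "P (\<Sum>n<N. smult (c n) (tau lam n)) f =
      ext_pairing lam (\<Sum>n<N. smult (c n) (tau lam n)) f" for N c
  proof (induction N)
    case 0
    show ?case using smult_left[of 0 0] by (simp add: ext_pairing_zero_left)
  next
    case (Suc N)
    then show ?case
      by (simp add: add_left smult_left ext_pairing_add_left ext_pairing_smult_left tau)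
  qed
  obtain N where "g = (\<Sum>n<N. smult (tau_coeffs lam g n) (tau lam n))"
    using tau_expansion_tau_coeffs[of lam g] unfolding tau_expansion_iff by blast
  then show ?thesis using sum by metis
qed

end

theory Submission
  imports Defs
begin

text \<open>Both extended pairings equal \<open>B(g, h) = \<Sum>\<^sub>j j! g\<^sub>j h\<^sub>j\<close>, which does not involve \<open>\<lambda>\<close>.
  Under \<open>B\<close>, multiplication by \<open>t\<close> is adjoint to \<open>d/dx\<close>. Write
  \<open>p\<^sub>n = t (t - \<lambda>) \<cdots> (t - (n - 1) \<lambda>)\<close> and \<open>e = e\<^sub>\<lambda>(x)\<close>. Since \<open>e' = 1 + \<lambda> e\<close>, the recurrence
  \<open>p\<^sub>n\<^sub>+\<^sub>1 = (t - n \<lambda>) p\<^sub>n\<close> becomes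
  \<open>B(p\<^sub>n\<^sub>+\<^sub>1, e\<^sup>k) = k B(p\<^sub>n, e\<^sup>k\<^sup>-\<^sup>1) + (k - n) \<lambda> B(p\<^sub>n, e\<^sup>k)\<close>,
  and induction on \<open>n\<close> gives \<open>B(p\<^sub>n, e\<^sup>k) = n! \<delta>\<^sub>n\<^sub>k\<close>.\<close>

definition coeff_pairing :: "'a::comm_ring_1 poly \<Rightarrow> 'a fps \<Rightarrow> 'a" where
  "coeff_pairing g h = (\<Sum>j\<le>degree g. of_nat (fact j) * coeff g j * fps_nth h j)"

text \<open>Coefficients beyond the degree vanish, so polynomials of different degrees can share one
  summation range.\<close>

lemma coeff_pairing_eq_sum:
  assumes "degree g \<le> N"
  shows "coeff_pairing g h = (\<Sum>j\<le>N. of_nat (fact j) * coeff g j * fps_nth h j)"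
  unfolding coeff_pairing_def using assms
  by (intro sum.mono_neutral_left) (auto simp: coeff_eq_0)

lemma coeff_pairing_add_left:
  "coeff_pairing (g + g') h = coeff_pairing g h + coeff_pairing g' h"
proof -
  define N where "N = max (degree g) (degree g')"
  have "degree g \<le> N" "degree g' \<le> N" "degree (g + g') \<le> N"
    by (auto simp: N_def degree_add_le_max)
  from this[THEN coeff_pairing_eq_sum] show ?thesis
    by (simp add: sum.distrib algebra_simps)
qed

lemma coeff_pairing_smult_left: "coeff_pairing (smult c g) h = c * coeff_pairing g h"
  unfolding coeff_pairing_eq_sum[OF degree_smult_le] coeff_pairing_def[of g]
  by (simp add: sum_distrib_left algebra_simps)

lemma coeff_pairing_sum_left:
  "coeff_pairing (\<Sum>i\<in>A. g i) h = (\<Sum>i\<in>A. coeff_pairing (g i) h)"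
proof (induction A rule: infinite_finite_induct)
  case (insert i A)
  then show ?case by (simp add: coeff_pairing_add_left)
qed (simp_all add: coeff_pairing_def)

lemma coeff_pairing_add_right:
  "coeff_pairing g (h + h') = coeff_pairing g h + coeff_pairing g h'"
  by (simp add: coeff_pairing_def sum.distrib algebra_simps)

lemma coeff_pairing_const_mult_right:
  "coeff_pairing g (fps_const c * h) = c * coeff_pairing g h"
  by (simp add: coeff_pairing_def sum_distrib_left algebra_simps)

text \<open>After an index shift, (j + 1)! = (j + 1) j! supplies exactly the factor that
  differentiation puts on the coefficient of x^(j + 1).\<close>

lemma coeff_pairing_pCons_0: "coeff_pairing (pCons 0 g) h = coeff_pairing g (fps_deriv h)"
proof -
  have "coeff_pairing (pCons 0 g) h =
      (\<Sum>j\<le>Suc (degree g). of_nat (fact j) * coeff (pCons 0 g) j * fps_nth h j)"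
    by (rule coeff_pairing_eq_sum[OF degree_pCons_le])
  also have "\<dots> = (\<Sum>j\<le>degree g. of_nat (fact (Suc j)) * coeff g j * fps_nth h (Suc j))"
    by (simp add: sum.atMost_Suc_shift del: sum.atMost_Suc)
  also have "\<dots> = coeff_pairing g (fps_deriv h)"
    by (simp add: coeff_pairing_def algebra_simps)
  finally show ?thesis .
qed

text \<open>Both sides are the exponential series of \<open>lam\<close> x, with coefficients
  \<open>lam ^ k\<close> / k!.\<close>

lemma fps_deriv_e_fps: "fps_deriv (e_fps lam) = 1 + fps_const lam * e_fps lam"
proof (rule fps_ext)
  fix k
  have "of_nat (Suc k) * ((1 / fact (Suc k)) *\<^sub>Q lam ^ k) = (1 / fact k) *\<^sub>Q lam ^ k"
  proof -
    have "of_nat (Suc k) * (1 / fact (Suc k)) = (1 / fact k :: rat)"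
      by (simp only: fact_Suc of_nat_mult) simp
    then show ?thesis
      by (metis of_nat_scaleQ scaleQ_scaleQ)
  qed
  moreover have "lam * (c *\<^sub>Q lam ^ j) = c *\<^sub>Q lam ^ Suc j" for c j
    by (metis mult.commute mult_scaleQ_left power_Suc)
  ultimately show "fps_nth (fps_deriv (e_fps lam)) k = fps_nth (1 + fps_const lam * e_fps lam) k"
    by (cases k) (simp_all add: e_fps_def scaleQ_one)
qed

text \<open>Chain rule. For \<open>k = 0\<close> the truncated exponent \<open>k - 1\<close> is
  harmless, as its factor is 0.\<close>

lemma fps_deriv_e_fps_power:
  "fps_deriv (e_fps lam ^ k) =
     fps_const (of_nat k) * e_fps lam ^ (k - 1) + fps_const (of_nat k * lam) * e_fps lam ^ k"
proof (cases k)
  case (Suc m)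
  have "fps_deriv (e_fps lam ^ k) =
      fps_const (of_nat k) * (1 + fps_const lam * e_fps lam) * e_fps lam ^ m"
    by (simp only: Suc fps_deriv_power fps_deriv_e_fps diff_Suc_1)
  then show ?thesis
    by (simp add: Suc distrib_left distrib_right mult.assoc del: of_nat_Suc flip: fps_const_mult)
qed simp

lemma coeff_pairing_falling_e_fps_power:
  "coeff_pairing (\<Prod>i<n. [:- (of_nat i * lam), 1:]) (e_fps lam ^ k) =
     (if n = k then of_nat (fact n) else 0)"
proof (induction n arbitrary: k)
  case 0
  then show ?case
    by (simp add: coeff_pairing_def e_fps_power_nth)
next
  case (Suc n)
  define p where "p = (\<Prod>i<n. [:- (of_nat i * lam), 1:])"
  have "(\<Prod>i<Suc n. [:- (of_nat i * lam), 1:]) = smult (- (of_nat n * lam)) p + pCons 0 p"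
    by (simp add: p_def mult.commute)
  then have "coeff_pairing (\<Prod>i<Suc n. [:- (of_nat i * lam), 1:]) (e_fps lam ^ k) =
      of_nat k * coeff_pairing p (e_fps lam ^ (k - 1)) +
      (of_nat k - of_nat n) * lam * coeff_pairing p (e_fps lam ^ k)"
    by (simp only: coeff_pairing_add_left coeff_pairing_smult_left coeff_pairing_pCons_0
        fps_deriv_e_fps_power coeff_pairing_add_right coeff_pairing_const_mult_right)
      (simp add: algebra_simps)
  \<comment> \<open>By induction the first term survives only for \<open>k = Suc n\<close>, giving
    (n + 1) n!; the second could survive only for \<open>k = n\<close>, where its factor k - n is
    0.\<close>
  also have "\<dots> = (if Suc n = k then of_nat (fact (Suc n)) else 0)"
    unfolding p_def Suc.IH by (cases k) (auto simp: algebra_simps)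
  finally show ?case .
qed

lemma coeff_pairing_tau_e_fps_power:
  fixes lam :: "'a::comm_rat_algebra_1"
  shows "coeff_pairing (tau lam n) (e_fps lam ^ k) = (if n = k then 1 else 0)"
  using fact_scaleQ[of n, where ?'a = 'a]
  by (auto simp: tau_def coeff_pairing_smult_left coeff_pairing_falling_e_fps_power mult.commute[of "_ *\<^sub>Q 1"])

text \<open>As \<open>tau lam n\<close> has degree at most n, only coefficients of \<open>h\<close>
  up to n matter, and these involve only the powers \<open>e_fps lam ^ k\<close> with k \<le> n. The
  infinite expansion thus becomes a finite sum.\<close>

lemma coeff_pairing_tau: "coeff_pairing (tau lam n) h = e_coeffs lam h n"
proof -
  have deg: "degree (tau lam n) \<le> n"
    by (simp add: degree_le coeff_tau_eq_0)
  have h: "fps_nth h j = (\<Sum>k\<le>n. e_coeffs lam h k * fps_nth (e_fps lam ^ k) j)" if "j \<le> n" for j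
  proof -
    have "fps_nth h j = (\<Sum>k\<le>j. e_coeffs lam h k * fps_nth (e_fps lam ^ k) j)"
      using e_expansion_e_coeffs[of lam h] by (simp add: e_expansion_iff)
    \<comment> \<open>A bound independent of j lets the two sums be swapped below.\<close>
    also have "\<dots> = (\<Sum>k\<le>n. e_coeffs lam h k * fps_nth (e_fps lam ^ k) j)"
      using that by (intro sum.mono_neutral_left) (auto simp: e_fps_power_nth)
    finally show ?thesis .
  qed
  have "coeff_pairing (tau lam n) h =
      (\<Sum>j\<le>n. \<Sum>k\<le>n. e_coeffs lam h k *
        (of_nat (fact j) * coeff (tau lam n) j * fps_nth (e_fps lam ^ k) j))"
    by (simp add: coeff_pairing_eq_sum[OF deg] h sum_distrib_left mult_ac)
  also have "\<dots> = (\<Sum>k\<le>n. e_coeffs lam h k * coeff_pairing (tau lam n) (e_fps lam ^ k))"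
    unfolding coeff_pairing_eq_sum[OF deg] sum_distrib_left by (rule sum.swap)
  also have "\<dots> = e_coeffs lam h n"
    by (simp add: coeff_pairing_tau_e_fps_power if_distrib[of "\<lambda>c. _ * c"] cong: if_cong)
  finally show ?thesis .
qed

lemma ext_pairing_eq_coeff_pairing: "ext_pairing lam g h = coeff_pairing g h"
proof -
  have "g = (\<Sum>n | tau_coeffs lam g n \<noteq> 0. smult (tau_coeffs lam g n) (tau lam n))"
    using tau_expansion_tau_coeffs[of lam g] by (simp add: tau_expansion_def)
  then have "coeff_pairing g h =
      coeff_pairing (\<Sum>n | tau_coeffs lam g n \<noteq> 0. smult (tau_coeffs lam g n) (tau lam n)) h"
    by simp
  also have "\<dots> = ext_pairing lam g h"
    by (simp add: ext_pairing_def coeff_pairing_sum_left coeff_pairing_smult_left coeff_pairing_tau)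
  finally show ?thesis ..
qed

theorem theorem4p7:
  fixes lam :: "'a::comm_rat_algebra_1"
  shows "\<forall>(g :: 'a poly) (h :: 'a fps). ext_pairing 0 g h = ext_pairing lam g h"
  by (simp add: ext_pairing_eq_coeff_pairing)

end
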